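(* The diamond graph $K_4-e$ (the complete graph on $4$ vertices with one edge removed) is not isomorphic to $\mathcal{B}_k(G)$ for any finite simple graph $G$ and positive integer $k$.
   Context: A stable $k$-partition of a graph $G$ is a multiset $P=\{V_1,\dots,V_k\}$ of $k$ independent sets of $G$ (some possibly empty) that partition $V(G)$. For $v\in V(G)$, $P-v$ denotes the multiset $\{V_i\setminus\{v\}:1\le i\le k\}$. The Bell $k$-coloring graph $\mathcal{B}_k(G)$ has as vertices all stable $k$-partitions of $G$, and two distinct partitions $P,Q$ are adjacent if and only if $P-v=Q-v$ for some $v\in V(G)$. *)

theory Defs
  imports
    "Graph_Theory.Graph_Theory"
    "HOL-Library.Multiset"
    "HOL-Library.Disjoint_Sets"
    "HOL-Library.FuncSet"
begin

text \<open>
  A finite simple graph is a \<^const>\<open>pair_graph\<close>: a finite vertex set with a finite, symmetric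
  and loop-free set of arcs, each undirected edge being represented by its two opposite arcs.
\<close>

definition independent_set :: "'a pair_pre_digraph \<Rightarrow> 'a set \<Rightarrow> bool" where
  "independent_set G S \<longleftrightarrow> S \<subseteq> pverts G \<and> (\<forall>u\<in>S. \<forall>v\<in>S. (u, v) \<notin> parcs G)"

text \<open>
  Disjointness is required of the family of parts rather than of the underlying set of parts, so
  that the empty part may be repeated but a nonempty part may not.
\<close>

definition stable_partition :: "nat \<Rightarrow> 'a pair_pre_digraph \<Rightarrow> 'a set multiset \<Rightarrow> bool" where
  "stable_partition k G P \<longleftrightarrow>
    (\<exists>V. P = image_mset V (mset_set {1..k}) \<and>
      (\<forall>i\<in>{1..k}. independent_set G (V i)) \<and>
      disjoint_family_on V {1..k} \<and>
      (\<Union>i\<in>{1..k}. V i) = pverts G)"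

definition partition_delete :: "'a set multiset \<Rightarrow> 'a \<Rightarrow> 'a set multiset" where
  "partition_delete P v = image_mset (\<lambda>S. S - {v}) P"

definition bell_coloring_graph ::
    "nat \<Rightarrow> 'a pair_pre_digraph \<Rightarrow> 'a set multiset pair_pre_digraph" where
  "bell_coloring_graph k G = \<lparr>
    pverts = {P. stable_partition k G P},
    parcs = {(P, Q). stable_partition k G P \<and> stable_partition k G Q \<and> P \<noteq> Q \<and>
      (\<exists>v\<in>pverts G. partition_delete P v = partition_delete Q v)}\<rparr>"

definition diamond_graph :: "nat pair_pre_digraph" where
  "diamond_graph = \<lparr>
    pverts = {0, 1, 2, 3},
    parcs = {(u, v). u \<in> {0, 1, 2, 3} \<and> v \<in> {0, 1, 2, 3} \<and> u \<noteq> v} - {(0, 1), (1, 0)}\<rparr>"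

lemma pair_graph_diamond_graph: "pair_graph diamond_graph"
proof -
  have "finite (parcs diamond_graph)"
    by (rule finite_subset[of _ "{0, 1, 2, 3} \<times> {0, 1, 2, 3}"]) (auto simp: diamond_graph_def)
  moreover have "sym (parcs diamond_graph)"
    by (rule symI) (auto simp: diamond_graph_def)
  ultimately show ?thesis
    by unfold_locales (auto simp: diamond_graph_def symmetric_def)
qed

lemma finite_stable_partitions:
  assumes "finite (pverts G)"
  shows "finite {P. stable_partition k G P}"
proof (rule finite_subset)
  show "{P. stable_partition k G P} \<subseteq>
      (\<lambda>V. image_mset V (mset_set {1..k})) ` ({1..k} \<rightarrow>\<^sub>E Pow (pverts G))"
  proof
    fix P assume "P \<in> {P. stable_partition k G P}"
    then obtain V where P: "P = image_mset V (mset_set {1..k})"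
      and V: "(\<Union>i\<in>{1..k}. V i) = pverts G"
      by (auto simp: stable_partition_def)
    have "P = image_mset (restrict V {1..k}) (mset_set {1..k})"
      unfolding P by (rule image_mset_cong) simp
    moreover have "restrict V {1..k} \<in> {1..k} \<rightarrow>\<^sub>E Pow (pverts G)"
      using V by auto
    ultimately show "P \<in> (\<lambda>V. image_mset V (mset_set {1..k})) ` ({1..k} \<rightarrow>\<^sub>E Pow (pverts G))"
      by blast
  qed
  show "finite ((\<lambda>V. image_mset V (mset_set {1..k})) ` ({1..k} \<rightarrow>\<^sub>E Pow (pverts G)))"
    using assms by (intro finite_imageI finite_PiE) auto
qed

lemma pair_graph_bell_coloring_graph:
  assumes "pair_graph G"
  shows "pair_graph (bell_coloring_graph k G)"
proof -
  interpret pair_graph G by fact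
  let ?B = "bell_coloring_graph k G"
  have fin: "finite (pverts ?B)"
    using finite_stable_partitions[OF pair_finite_verts] by (simp add: bell_coloring_graph_def)
  have "finite (parcs ?B)"
    by (rule finite_subset[of _ "pverts ?B \<times> pverts ?B"])
      (use fin in \<open>auto simp: bell_coloring_graph_def\<close>)
  moreover have "sym (parcs ?B)"
    by (rule symI) (auto simp: bell_coloring_graph_def, metis)
  ultimately show ?thesis
    using fin by unfold_locales (auto simp: bell_coloring_graph_def symmetric_def)
qed

end

theory Submission
  imports Defs
begin

text \<open>
  A stable \<open>k\<close>-partition is the multiset of colour classes of a proper \<open>k\<close>-colouring, and two
  colourings give the same partition iff they have the same kernel.

  In a triangle \<open>P, Q, R\<close> of the Bell graph, either one vertex accounts for all three adjacencies,
  or three different vertices \<open>x, y, z\<close> do. In the latter case the three partitions agree on every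
  pair not contained in \<open>{x, y, z}\<close>, and this triple is an independent set and a union of classes;
  splitting it into at most two classes in all four ways gives a \<open>K\<^sub>4\<close>.

  In a Bell graph isomorphic to the diamond, with nonadjacent vertices \<open>A, B\<close> and the others
  \<open>C, D\<close>, there is no \<open>K\<^sub>4\<close>. So \<open>A, C, D\<close> agree off some \<open>v\<close> and \<open>B, C, D\<close> agree off some \<open>w\<close>,
  where \<open>v \<noteq> w\<close>. Hence, up to swapping, \<open>C\<close> has a class \<open>{v, w}\<close> that \<open>D\<close> splits into \<open>{v}\<close> and
  \<open>{w}\<close>. Then \<open>A\<close> arises from \<open>D\<close> by moving \<open>v\<close> into some other class, \<open>B\<close> by moving \<open>w\<close>, and
  performing both moves yields a fifth stable partition.
\<close>

section \<open>Stable partitions as kernels of colourings\<close>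

definition same_kernel_on :: "'a set \<Rightarrow> ('a \<Rightarrow> 'b) \<Rightarrow> ('a \<Rightarrow> 'c) \<Rightarrow> bool" where
  "same_kernel_on W f g \<longleftrightarrow> (\<forall>u\<in>W. \<forall>v\<in>W. f u = f v \<longleftrightarrow> g u = g v)"

definition proper_coloring :: "nat \<Rightarrow> 'a pair_pre_digraph \<Rightarrow> ('a \<Rightarrow> nat) \<Rightarrow> bool" where
  "proper_coloring k G f \<longleftrightarrow> f ` pverts G \<subseteq> {1..k} \<and>
    (\<forall>u\<in>pverts G. \<forall>v\<in>pverts G. (u, v) \<in> parcs G \<longrightarrow> f u \<noteq> f v)"

text \<open>Indexing by all of \<open>{1..k}\<close> records empty classes as well, so a class that
  becomes empty when a vertex is deleted still counts among the \<open>k\<close> members.\<close>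

definition color_classes :: "nat \<Rightarrow> 'a set \<Rightarrow> ('a \<Rightarrow> nat) \<Rightarrow> 'a set multiset" where
  "color_classes k W f = image_mset (\<lambda>i. {u \<in> W. f u = i}) (mset_set {1..k})"

lemma same_kernel_onD:
  "same_kernel_on W f g \<Longrightarrow> u \<in> W \<Longrightarrow> v \<in> W \<Longrightarrow> f u = f v \<longleftrightarrow> g u = g v"
  by (auto simp: same_kernel_on_def)

lemma proper_coloringD:
  "proper_coloring k G f \<Longrightarrow> u \<in> pverts G \<Longrightarrow> v \<in> pverts G \<Longrightarrow> f u = f v \<Longrightarrow> (u, v) \<notin> parcs G"
  by (auto simp: proper_coloring_def)

text \<open>Each colour taken on \<open>W\<close> yields its own nonempty class, and every other
  colour in \<open>{1..k}\<close> yields an empty set. The resulting expression depends on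
  \<open>f\<close> only through its kernel.\<close>

lemma color_classes_eq_nonempty_plus_empty:
  assumes "f ` W \<subseteq> {1..k}"
  defines "\<C> \<equiv> (\<lambda>x. {u \<in> W. f u = f x}) ` W"
  shows "color_classes k W f = mset_set \<C> + replicate_mset (k - card \<C>) {}"
proof -
  let ?c = "\<lambda>i. {u \<in> W. f u = i}"
  have fin: "finite (f ` W)"
    using assms(1) by (rule finite_subset) simp
  have inj: "inj_on ?c (f ` W)"
    by (rule inj_onI) auto
  have im: "?c ` (f ` W) = \<C>"
    by (auto simp: \<C>_def)
  have card: "card \<C> = card (f ` W)"
    using card_image[OF inj] im by simp
  have "{1..k} = f ` W \<union> ({1..k} - f ` W)"
    using assms(1) by auto
  then have "mset_set {1..k} = mset_set (f ` W) + mset_set ({1..k} - f ` W)"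
    using fin mset_set_Union[of "f ` W" "{1..k} - f ` W"] by auto
  moreover have "image_mset ?c (mset_set (f ` W)) = mset_set \<C>"
    using image_mset_mset_set[OF inj] im by simp
  moreover have "image_mset ?c (mset_set ({1..k} - f ` W)) =
      image_mset (\<lambda>_. {}) (mset_set ({1..k} - f ` W))"
    by (rule image_mset_cong) auto
  ultimately show ?thesis
    using assms(1) fin by (simp add: color_classes_def image_mset_const_eq card card_Diff_subset)
qed

lemma color_classes_eq_iff:
  assumes f: "f ` W \<subseteq> {1..k}" and g: "g ` W \<subseteq> {1..k}"
  shows "color_classes k W f = color_classes k W g \<longleftrightarrow> same_kernel_on W f g"
proof
  \<comment> \<open>This recovers the kernel from the multiset alone.\<close>
  have rel: "h u = h v \<longleftrightarrow> (\<exists>S. S \<in># color_classes k W h \<and> u \<in> S \<and> v \<in> S)"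
    if "h ` W \<subseteq> {1..k}" "u \<in> W" "v \<in> W" for h u v
    using that by (force simp: color_classes_def)
  assume "color_classes k W f = color_classes k W g"
  then show "same_kernel_on W f g"
    using rel[OF f] rel[OF g] by (auto simp: same_kernel_on_def)
next
  assume "same_kernel_on W f g"
  then have "(\<lambda>x. {u \<in> W. f u = f x}) ` W = (\<lambda>x. {u \<in> W. g u = g x}) ` W"
    by (intro image_cong) (auto simp: same_kernel_on_def)
  then show "color_classes k W f = color_classes k W g"
    by (simp add: color_classes_eq_nonempty_plus_empty[OF f]
        color_classes_eq_nonempty_plus_empty[OF g])
qed

lemma partition_delete_color_classes:
  "partition_delete (color_classes k W f) v = color_classes k (W - {v}) f"
  by (auto simp: partition_delete_def color_classes_def multiset.map_comp intro!: image_mset_cong)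

text \<open>The colour of a vertex is the index of the part containing it, unique because the
  indexed family is disjoint.\<close>

lemma stable_partition_iff_proper_coloring:
  "stable_partition k G P \<longleftrightarrow>
    (\<exists>f. proper_coloring k G f \<and> P = color_classes k (pverts G) f)"
proof
  assume "stable_partition k G P"
  then obtain V where P: "P = image_mset V (mset_set {1..k})"
    and ind: "\<And>i. i \<in> {1..k} \<Longrightarrow> independent_set G (V i)"
    and disj: "disjoint_family_on V {1..k}"
    and un: "(\<Union>i\<in>{1..k}. V i) = pverts G"
    by (auto simp: stable_partition_def)
  have "\<forall>u\<in>pverts G. \<exists>i. i \<in> {1..k} \<and> u \<in> V i"
    using un by blast
  then obtain f where f: "\<And>u. u \<in> pverts G \<Longrightarrow> f u \<in> {1..k} \<and> u \<in> V (f u)"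
    by metis
  have V: "V i = {u \<in> pverts G. f u = i}" if "i \<in> {1..k}" for i
  proof -
    have "f u = i" if "u \<in> V i" for u
      using disj f[of u] that \<open>i \<in> {1..k}\<close> un by (fastforce simp: disjoint_family_on_def)
    then show ?thesis
      using f un that by blast
  qed
  have "P = color_classes k (pverts G) f"
    unfolding P color_classes_def by (rule image_mset_cong) (use V in auto)
  moreover have "proper_coloring k G f"
    unfolding proper_coloring_def
  proof (intro conjI ballI impI)
    show "f ` pverts G \<subseteq> {1..k}"
      using f by auto
    fix u v assume uv: "u \<in> pverts G" "v \<in> pverts G" "(u, v) \<in> parcs G"
    then show "f u \<noteq> f v"
      using f[of u] f[of v] ind[of "f u"] by (auto simp: independent_set_def)
  qed
  ultimately show "\<exists>f. proper_coloring k G f \<and> P = color_classes k (pverts G) f"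
    by blast
next
  assume "\<exists>f. proper_coloring k G f \<and> P = color_classes k (pverts G) f"
  then obtain f where f: "proper_coloring k G f" and P: "P = color_classes k (pverts G) f"
    by blast
  show "stable_partition k G P"
    unfolding stable_partition_def
    by (rule exI[of _ "\<lambda>i. {u \<in> pverts G. f u = i}"])
      (use f in \<open>fastforce simp: P color_classes_def independent_set_def disjoint_family_on_def
        proper_coloring_def\<close>)
qed

lemma pverts_bell_coloring_graph:
  "pverts (bell_coloring_graph k G) =
    color_classes k (pverts G) ` {f. proper_coloring k G f}"
  by (auto simp: bell_coloring_graph_def stable_partition_iff_proper_coloring)

lemma color_classes_eq_iff_proper:
  assumes "proper_coloring k G f" "proper_coloring k G g"
  shows "color_classes k (pverts G) f = color_classes k (pverts G) g \<longleftrightarrow>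
    same_kernel_on (pverts G) f g"
  using assms by (intro color_classes_eq_iff) (auto simp: proper_coloring_def)

lemma partition_delete_eq_iff_proper:
  assumes "proper_coloring k G f" "proper_coloring k G g"
  shows "partition_delete (color_classes k (pverts G) f) v =
      partition_delete (color_classes k (pverts G) g) v \<longleftrightarrow>
    same_kernel_on (pverts G - {v}) f g"
  unfolding partition_delete_color_classes
  using assms by (intro color_classes_eq_iff) (auto simp: proper_coloring_def)

text \<open>Reduces adjacency to kernels, the form in which the arguments below produce and use
  arcs.\<close>

lemma bell_arc_iff:
  assumes "proper_coloring k G f" "proper_coloring k G g"
  shows "(color_classes k (pverts G) f, color_classes k (pverts G) g)
      \<in> parcs (bell_coloring_graph k G) \<longleftrightarrow>
    \<not> same_kernel_on (pverts G) f g \<and>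
    (\<exists>v\<in>pverts G. same_kernel_on (pverts G - {v}) f g)"
  using assms
  by (auto simp: bell_coloring_graph_def stable_partition_iff_proper_coloring
      color_classes_eq_iff_proper partition_delete_eq_iff_proper)

section \<open>Triangles and cliques of size four\<close>

definition has_bell_K4 :: "nat \<Rightarrow> 'a pair_pre_digraph \<Rightarrow> bool" where
  "has_bell_K4 k G \<longleftrightarrow> (\<exists>F \<subseteq> pverts (bell_coloring_graph k G). card F = 4 \<and>
    (\<forall>P\<in>F. \<forall>Q\<in>F. P \<noteq> Q \<longrightarrow> (P, Q) \<in> parcs (bell_coloring_graph k G)))"

lemma isolated_triple_has_bell_K4:
  assumes t: "proper_coloring k G t"
    and V: "x \<in> pverts G" "y \<in> pverts G" "z \<in> pverts G"
    and dist: "x \<noteq> y" "x \<noteq> z" "y \<noteq> z"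
    and indep: "\<And>u v. u \<in> {x, y, z} \<Longrightarrow> v \<in> {x, y, z} \<Longrightarrow> (u, v) \<notin> parcs G"
    and ij: "i \<in> {1..k}" "j \<in> {1..k}" "i \<noteq> j"
    and unused: "\<And>u. u \<in> pverts G \<Longrightarrow> u \<notin> {x, y, z} \<Longrightarrow> t u \<noteq> i \<and> t u \<noteq> j"
  shows "has_bell_K4 k G"
proof -
  let ?C = "color_classes k (pverts G)"
  \<comment> \<open>\<open>s0\<close> keeps the triple together in colour \<open>i\<close>; each of
    the others splits off the vertex it is named after, in colour \<open>j\<close>.\<close>
  define s0 where "s0 = t(x := i, y := i, z := i)"
  define sx where "sx = t(x := j, y := i, z := i)"
  define sy where "sy = t(x := i, y := j, z := i)"
  define sz where "sz = t(x := i, y := i, z := j)"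
  note s_defs = s0_def sx_def sy_def sz_def
  \<comment> \<open>One argument covers all four colourings: the triple is independent, and
    \<open>t\<close> takes the colours \<open>i\<close> and \<open>j\<close> nowhere outside
    it.\<close>
  have *: "proper_coloring k G s"
    if s: "\<And>u. u \<notin> {x, y, z} \<Longrightarrow> s u = t u" "\<And>u. u \<in> {x, y, z} \<Longrightarrow> s u \<in> {i, j}" for s
    unfolding proper_coloring_def
  proof (intro conjI ballI impI)
    show "s ` pverts G \<subseteq> {1..k}"
    proof
      fix c assume "c \<in> s ` pverts G"
      then obtain u where "u \<in> pverts G" "c = s u" by blast
      then show "c \<in> {1..k}"
        using s[of u] t ij by (cases "u \<in> {x, y, z}") (auto simp: proper_coloring_def)
    qed
    fix u v assume uv: "u \<in> pverts G" "v \<in> pverts G" "(u, v) \<in> parcs G"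
    show "s u \<noteq> s v"
    proof (cases "u \<in> {x, y, z}"; cases "v \<in> {x, y, z}")
      assume "u \<in> {x, y, z}" "v \<in> {x, y, z}"
      then show ?thesis using indep uv by blast
    next
      assume "u \<in> {x, y, z}" "v \<notin> {x, y, z}"
      then show ?thesis using s(1)[of v] s(2)[of u] unused[of v] uv by auto
    next
      assume "u \<notin> {x, y, z}" "v \<in> {x, y, z}"
      then show ?thesis using s(1)[of u] s(2)[of v] unused[of u] uv by auto
    next
      assume "u \<notin> {x, y, z}" "v \<notin> {x, y, z}"
      then show ?thesis using s(1)[of u] s(1)[of v] t uv by (auto simp: proper_coloring_def)
    qed
  qed
  have proper: "proper_coloring k G s0" "proper_coloring k G sx" "proper_coloring k G sy"
    "proper_coloring k G sz"
    by (rule *; auto simp: s_defs)+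
  have neq: "\<not> same_kernel_on (pverts G) s0 sx" "\<not> same_kernel_on (pverts G) s0 sy"
    "\<not> same_kernel_on (pverts G) s0 sz"
    using dist ij(3) V same_kernel_onD[of "pverts G" s0 sx x y]
      same_kernel_onD[of "pverts G" s0 sy x y] same_kernel_onD[of "pverts G" s0 sz x z]
    by (auto simp: s_defs)
  moreover have "\<not> same_kernel_on (pverts G) sx sy" "\<not> same_kernel_on (pverts G) sx sz"
    "\<not> same_kernel_on (pverts G) sy sz"
    using dist ij(3) V same_kernel_onD[of "pverts G" sx sy x z]
      same_kernel_onD[of "pverts G" sx sz x y] same_kernel_onD[of "pverts G" sy sz x y]
    by (auto simp: s_defs)
  moreover have "same_kernel_on (pverts G - {x}) s0 sx" "same_kernel_on (pverts G - {y}) s0 sy"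
    "same_kernel_on (pverts G - {z}) s0 sz"
    by (auto simp: same_kernel_on_def s_defs)
  \<comment> \<open>Once the third vertex is removed, both colourings put each of the other two into
    a singleton class.\<close>
  moreover have "same_kernel_on (pverts G - {z}) sx sy" "same_kernel_on (pverts G - {y}) sx sz"
    "same_kernel_on (pverts G - {x}) sy sz"
    using dist ij(3) unused by (auto simp: same_kernel_on_def s_defs)
  ultimately have arcs:
    "(?C s0, ?C sx) \<in> parcs (bell_coloring_graph k G)"
    "(?C s0, ?C sy) \<in> parcs (bell_coloring_graph k G)"
    "(?C s0, ?C sz) \<in> parcs (bell_coloring_graph k G)"
    "(?C sx, ?C sy) \<in> parcs (bell_coloring_graph k G)"
    "(?C sx, ?C sz) \<in> parcs (bell_coloring_graph k G)"
    "(?C sy, ?C sz) \<in> parcs (bell_coloring_graph k G)"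
    using V by (auto simp: bell_arc_iff proper)
  have sym: "(Q, P) \<in> parcs (bell_coloring_graph k G)"
    if "(P, Q) \<in> parcs (bell_coloring_graph k G)" for P Q
    using that by (auto simp: bell_coloring_graph_def) metis
  have irrefl: "P \<noteq> Q" if "(P, Q) \<in> parcs (bell_coloring_graph k G)" for P Q
    using that by (auto simp: bell_coloring_graph_def)
  have "card {?C s0, ?C sx, ?C sy, ?C sz} = 4"
    using arcs[THEN irrefl] by auto
  moreover have "{?C s0, ?C sx, ?C sy, ?C sz} \<subseteq> pverts (bell_coloring_graph k G)"
    using proper by (auto simp: pverts_bell_coloring_graph)
  ultimately show ?thesis
    unfolding has_bell_K4_def using arcs arcs[THEN sym]
    by (intro exI[of _ "{?C s0, ?C sx, ?C sy, ?C sz}"]) auto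
qed

lemma bell_triangle:
  assumes proper: "proper_coloring k G p" "proper_coloring k G q" "proper_coloring k G r"
    and V: "x \<in> pverts G" "y \<in> pverts G" "z \<in> pverts G"
    and pq: "same_kernel_on (pverts G - {x}) p q"
    and qr: "same_kernel_on (pverts G - {y}) q r"
    and pr: "same_kernel_on (pverts G - {z}) p r"
    and no_common: "\<And>w. w \<in> pverts G \<Longrightarrow>
      \<not> (same_kernel_on (pverts G - {w}) p q \<and> same_kernel_on (pverts G - {w}) q r)"
  shows "has_bell_K4 k G"
proof -
  \<comment> \<open>If two of these vertices coincided, transitivity would make that vertex account
    for all three pairs of colourings.\<close>
  have dist: "x \<noteq> y" "x \<noteq> z" "y \<noteq> z"
    using no_common[OF V(1)] no_common[OF V(2)] pq qr pr by (auto simp: same_kernel_on_def)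
  \<comment> \<open>If \<open>v\<close> lies in the triple, the two agreements that do not remove
    \<open>v\<close> still apply to \<open>u\<close>, \<open>v\<close> and imply the third.\<close>
  have outside: "(p u = p v \<longleftrightarrow> q u = q v) \<and> (q u = q v \<longleftrightarrow> r u = r v)"
    if "u \<in> pverts G" "v \<in> pverts G" "u \<notin> {x, y, z}" for u v
    using that dist same_kernel_onD[OF pq, of u v] same_kernel_onD[OF qr, of u v]
      same_kernel_onD[OF pr, of u v]
    by (cases "v = x"; cases "v = y"; cases "v = z"; simp)
  have outside': "(p v = p u \<longleftrightarrow> q v = q u) \<and> (q v = q u \<longleftrightarrow> r v = r u)"
    if "u \<in> pverts G" "v \<in> pverts G" "u \<notin> {x, y, z}" for u v
    using outside[OF that] by metis
  have pqr: "p y = p z \<longleftrightarrow> q y = q z" "q x = q z \<longleftrightarrow> r x = r z" "p x = p y \<longleftrightarrow> r x = r y"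
    using same_kernel_onD[OF pq, of y z] same_kernel_onD[OF qr, of x z]
      same_kernel_onD[OF pr, of x y] V dist by auto
  \<comment> \<open>If all three kernels agreed on the pair \<open>w'\<close>, \<open>w''\<close>,
    the remaining vertex \<open>w\<close> would be a common one, against
    \<open>no_common\<close>.\<close>
  have same: "same_kernel_on (pverts G - {w}) p q \<and> same_kernel_on (pverts G - {w}) q r"
    if "{x, y, z} = {w, w', w''}" "p w' = p w'' \<longleftrightarrow> q w' = q w''" "q w' = q w'' \<longleftrightarrow> r w' = r w''"
    for w w' w''
  proof -
    note w = that(2,3) that(2,3)[unfolded eq_commute[of _ "_ w''"]]
    have "(p u = p v \<longleftrightarrow> q u = q v) \<and> (q u = q v \<longleftrightarrow> r u = r v)"
      if uv: "u \<in> pverts G - {w}" "v \<in> pverts G - {w}" for u v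
    proof -
      consider "u \<notin> {x, y, z}" | "v \<notin> {x, y, z}" | "u \<in> {w', w''}" "v \<in> {w', w''}"
        using uv \<open>{x, y, z} = {w, w', w''}\<close> by blast
      then show ?thesis
      proof cases
        case 1
        then show ?thesis using outside[of u v] uv by blast
      next
        case 2
        then show ?thesis using outside'[of v u] uv by blast
      next
        case 3
        then show ?thesis using w by auto
      qed
    qed
    then show ?thesis by (auto simp: same_kernel_on_def)
  qed
  \<comment> \<open>On each pair of the triple exactly one kernel deviates from the other two:
    \<open>r\<close> on \<open>y\<close>, \<open>z\<close>, then \<open>p\<close> on
    \<open>x\<close>, \<open>z\<close>, then \<open>q\<close> on \<open>x\<close>, \<open>y\<close>.
    So every pair is monochromatic in some colouring, hence nonadjacent.\<close>
  have yz: "(q y = q z) \<noteq> (r y = r z)"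
    using no_common[OF V(1)] same[of x y z] pqr(1) by blast
  have xz: "(p x = p z) \<noteq> (q x = q z)"
    using no_common[OF V(2)] same[of y x z] pqr(2) by blast
  have xy: "(p x = p y) \<noteq> (q x = q y)"
    using no_common[OF V(3)] same[of z x y] pqr(3) by blast
  have nonarc: "(u, v) \<notin> parcs G"
    if "u \<in> pverts G" "v \<in> pverts G" "p u = p v \<or> q u = q v \<or> r u = r v" for u v
    using that proper by (auto simp: proper_coloring_def)
  have indep: "(u, v) \<notin> parcs G" if "u \<in> {x, y, z}" "v \<in> {x, y, z}" for u v
    by (rule nonarc) (use that V xy xz yz in auto)
  \<comment> \<open>An outside vertex \<open>u\<close> in the class of \<open>v\<close> would force
    \<open>p\<close> and \<open>q\<close> to agree on all pairs of the triple containing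
    \<open>v\<close>, but one of the pairs on which they differ, \<open>x\<close>, \<open>y\<close>
    or \<open>x\<close>, \<open>z\<close>, contains \<open>v\<close>.\<close>
  have isolated: "t u \<noteq> t v"
    if "t \<in> {p, q, r}" "u \<in> pverts G" "u \<notin> {x, y, z}" "v \<in> {x, y, z}" for t u v
  proof
    assume "t u = t v"
    then have eq: "p u = p v" "q u = q v"
      using outside[of u v] that V by auto
    have "p u = p w \<longleftrightarrow> q u = q w" if "w \<in> {x, y, z}" for w
      using outside[of u w] \<open>u \<in> pverts G\<close> \<open>u \<notin> {x, y, z}\<close> that V by auto
    then have "p v = p w \<longleftrightarrow> q v = q w" if "w \<in> {x, y, z}" for w
      using that eq by simp
    from this[of x] this[of y] this[of z] show False
      using xy xz \<open>v \<in> {x, y, z}\<close> by (elim insertE emptyE) (simp_all add: eq_commute)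
  qed
  \<comment> \<open>\<open>p\<close> and \<open>q\<close> agree on \<open>y\<close>,
    \<open>z\<close> and differ on the other two pairs. If \<open>p\<close> joins all three,
    \<open>q\<close> splits off only \<open>x\<close>; \<open>p\<close> cannot separate all three,
    since \<open>q\<close> would then join \<open>x\<close> to \<open>y\<close> and to
    \<open>z\<close> but not \<open>y\<close> to \<open>z\<close>. The two colours of
    \<open>t\<close> on the triple serve as \<open>i\<close> and \<open>j\<close>.\<close>
  have "\<exists>t\<in>{p, q}. (t x = t y \<and> t x \<noteq> t z) \<or> (t x = t z \<and> t x \<noteq> t y) \<or> (t y = t z \<and> t x \<noteq> t y)"
    using pqr xy xz yz by simp metis
  then obtain t u v where t: "t \<in> {p, q}" "u \<in> {x, y, z}" "v \<in> {x, y, z}" "t u \<noteq> t v"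
    by blast
  show ?thesis
  proof (rule isolated_triple_has_bell_K4[OF _ V dist indep])
    show t_proper: "proper_coloring k G t" using t proper by auto
    show "t u \<in> {1..k}" "t v \<in> {1..k}" "t u \<noteq> t v"
      using t t_proper V by (auto simp: proper_coloring_def)
    show "t w \<noteq> t u \<and> t w \<noteq> t v" if "w \<in> pverts G" "w \<notin> {x, y, z}" for w
      using isolated[of t w] that t by blast
  qed
qed

section \<open>Excluding the diamond\<close>

lemma fifth_coloring:
  assumes proper: "proper_coloring k G a" "proper_coloring k G b"
      "proper_coloring k G c" "proper_coloring k G d"
    and V: "v \<in> pverts G" "w \<in> pverts G"
    and ad: "same_kernel_on (pverts G - {v}) a d" and cd: "same_kernel_on (pverts G - {v}) c d"
    and bd: "same_kernel_on (pverts G - {w}) b d" and cd': "same_kernel_on (pverts G - {w}) c d"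
    and neq: "\<not> same_kernel_on (pverts G) a c" "\<not> same_kernel_on (pverts G) a d"
      "\<not> same_kernel_on (pverts G) b c" "\<not> same_kernel_on (pverts G) b d"
    and vw: "v \<noteq> w" "c v = c w" "d v \<noteq> d w"
  shows "\<exists>e. proper_coloring k G e \<and> (\<forall>f\<in>{a, b, c, d}. \<not> same_kernel_on (pverts G) e f)"
proof -
  \<comment> \<open>If \<open>d u = d v\<close>, then \<open>c u = c v = c w\<close> by agreement
    off \<open>w\<close>, so \<open>d u = d w\<close> by agreement off \<open>v\<close>,
    contradicting \<open>d v \<noteq> d w\<close>. The other case is symmetric.\<close>
  have dv: "d u \<noteq> d v" and dw: "d u \<noteq> d w" if "u \<in> pverts G" "u \<noteq> v" "u \<noteq> w" for u
    using same_kernel_onD[OF cd, of u w] same_kernel_onD[OF cd', of u v] V vw that by auto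
  \<comment> \<open>Otherwise the class of \<open>v\<close> under \<open>a\<close> would be
    \<open>{v, w}\<close> or \<open>{v}\<close>, giving \<open>a\<close> the kernel of
    \<open>c\<close> or of \<open>d\<close>. The local variables allow a second use with
    \<open>b\<close> and with \<open>v\<close>, \<open>w\<close> exchanged.\<close>
  have move: "\<exists>s\<in>pverts G - {v, w}. a s = a v"
    if V: "v \<in> pverts G" "w \<in> pverts G"
      and ad: "same_kernel_on (pverts G - {v}) a d" and cd: "same_kernel_on (pverts G - {v}) c d"
      and neq: "\<not> same_kernel_on (pverts G) a c" "\<not> same_kernel_on (pverts G) a d"
      and vw: "v \<noteq> w" "c v = c w"
      and dv: "\<And>u. u \<in> pverts G \<Longrightarrow> u \<noteq> v \<Longrightarrow> d u \<noteq> d v"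
      and dw: "\<And>u. u \<in> pverts G \<Longrightarrow> u \<noteq> v \<Longrightarrow> u \<noteq> w \<Longrightarrow> d u \<noteq> d w"
    for a v w
  proof (rule ccontr)
    assume "\<not> ?thesis"
    then have no: "a s \<noteq> a v" if "s \<in> pverts G" "s \<noteq> v" "s \<noteq> w" for s
      using that by auto
    show False
    proof (cases "a w = a v")
      case True
      have "a u = a v \<longleftrightarrow> c u = c v" if "u \<in> pverts G" for u
        using no[of u] True vw same_kernel_onD[OF cd, of u w] dw[of u] that V by auto
      moreover have "a u = a u' \<longleftrightarrow> c u = c u'"
        if "u \<in> pverts G" "u' \<in> pverts G" "u \<noteq> v" "u' \<noteq> v" for u u'
        using same_kernel_onD[OF cd, of u u'] same_kernel_onD[OF ad, of u u'] that by auto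
      ultimately have "same_kernel_on (pverts G) a c"
        unfolding same_kernel_on_def by metis
      then show False using neq by blast
    next
      case False
      have "a u = a v \<longleftrightarrow> d u = d v" if "u \<in> pverts G" for u
        using no[of u] False dv[of u] that by auto
      moreover have "a u = a u' \<longleftrightarrow> d u = d u'"
        if "u \<in> pverts G" "u' \<in> pverts G" "u \<noteq> v" "u' \<noteq> v" for u u'
        using same_kernel_onD[OF ad, of u u'] that by auto
      ultimately have "same_kernel_on (pverts G) a d"
        unfolding same_kernel_on_def by metis
      then show False using neq by blast
    qed
  qed
  have dv': "d u \<noteq> d v" if "u \<in> pverts G" "u \<noteq> v" for u
    using that dv[of u] vw(3) by (cases "u = w") auto
  have dw': "d u \<noteq> d w" if "u \<in> pverts G" "u \<noteq> w" for u
    using that dw[of u] vw(3) by (cases "u = v") auto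
  obtain s where s: "s \<in> pverts G" "s \<noteq> v" "s \<noteq> w" "a s = a v"
    using move[OF V ad cd neq(1,2) vw(1,2) dv' dw] by blast
  obtain t where t: "t \<in> pverts G" "t \<noteq> v" "t \<noteq> w" "b t = b w"
    using move[OF V(2,1) bd cd' neq(3,4) vw(1,2)[symmetric] dw' dv] by blast
  \<comment> \<open>Both moves at once: \<open>v\<close> joins the class of \<open>s\<close> as in
    \<open>a\<close>, and \<open>w\<close> that of \<open>t\<close> as in \<open>b\<close>.\<close>
  define e where "e = d(v := d s, w := d t)"
  have sv: "(u, v) \<notin> parcs G" "(v, u) \<notin> parcs G"
    if "u \<in> pverts G" "u \<noteq> v" "u \<noteq> w" "d u = d s" for u
    using same_kernel_onD[OF ad, of u s] that s V
      proper_coloringD[OF proper(1), of u v] proper_coloringD[OF proper(1), of v u] by auto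
  have tw: "(u, w) \<notin> parcs G" "(w, u) \<notin> parcs G"
    if "u \<in> pverts G" "u \<noteq> v" "u \<noteq> w" "d u = d t" for u
    using same_kernel_onD[OF bd, of u t] that t V
      proper_coloringD[OF proper(2), of u w] proper_coloringD[OF proper(2), of w u] by auto
  \<comment> \<open>When \<open>d s = d t\<close>, the vertices \<open>v\<close> and
    \<open>w\<close> land in the same class of \<open>e\<close>; they are nonadjacent because
    \<open>c\<close> joins them.\<close>
  have nonarc: "(v, w) \<notin> parcs G" "(w, v) \<notin> parcs G" "(v, v) \<notin> parcs G" "(w, w) \<notin> parcs G"
    using proper_coloringD[OF proper(3)] V vw(2) by simp_all
  have "proper_coloring k G e"
    unfolding proper_coloring_def
  proof (intro conjI ballI impI)
    show "e ` pverts G \<subseteq> {1..k}"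
      using proper(4) s t by (auto simp: e_def proper_coloring_def)
    fix u u' assume uu': "u \<in> pverts G" "u' \<in> pverts G" "(u, u') \<in> parcs G"
    then have "d u \<noteq> d u'" using proper(4) by (auto simp: proper_coloring_def)
    then show "e u \<noteq> e u'"
      using uu' sv[of u] sv[of u'] tw[of u] tw[of u'] nonarc vw by (auto simp: e_def)
  qed
  \<comment> \<open>\<open>e\<close> joins \<open>w\<close> to \<open>t\<close> and \<open>v\<close>
    to \<open>s\<close>. The first pair is separated by \<open>a\<close>, the second by
    \<open>b\<close>, \<open>c\<close> and \<open>d\<close>.\<close>
  moreover have "\<not> same_kernel_on (pverts G) e a"
    using same_kernel_onD[of _ e a w t] same_kernel_onD[OF ad, of w t] dw[of t] V s t vw
    by (auto simp: e_def)
  moreover have "\<not> same_kernel_on (pverts G) e b"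
    using same_kernel_onD[of _ e b v s] same_kernel_onD[OF bd, of v s] dv[of s] V s t vw
    by (auto simp: e_def)
  moreover have "\<not> same_kernel_on (pverts G) e c"
    using same_kernel_onD[of _ e c v s] same_kernel_onD[OF cd', of v s] dv[of s] V s t vw
    by (auto simp: e_def)
  moreover have "\<not> same_kernel_on (pverts G) e d"
    using same_kernel_onD[of _ e d v s] dv[of s] V s t vw
    by (auto simp: e_def)
  ultimately show ?thesis by blast
qed

lemma bell_not_diamond:
  assumes verts: "pverts (bell_coloring_graph k G) = {A, B, C, D}"
    and nonarc: "A \<noteq> B" "(A, B) \<notin> parcs (bell_coloring_graph k G)"
    and arcs: "(A, C) \<in> parcs (bell_coloring_graph k G)" "(A, D) \<in> parcs (bell_coloring_graph k G)"
      "(B, C) \<in> parcs (bell_coloring_graph k G)" "(B, D) \<in> parcs (bell_coloring_graph k G)"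
      "(C, D) \<in> parcs (bell_coloring_graph k G)"
  shows False
proof -
  let ?C = "color_classes k (pverts G)" and ?V = "pverts G"
  have "{A, B, C, D} \<subseteq> ?C ` {f. proper_coloring k G f}"
    using verts pverts_bell_coloring_graph[of k G] by simp
  then obtain a b c d where proper: "proper_coloring k G a" "proper_coloring k G b"
      "proper_coloring k G c" "proper_coloring k G d"
    and ABCD: "A = ?C a" "B = ?C b" "C = ?C c" "D = ?C d"
    by (simp add: image_iff) metis
  have same_sym: "same_kernel_on W f g \<longleftrightarrow> same_kernel_on W g f" for W and f g :: "'a \<Rightarrow> nat"
    by (auto simp: same_kernel_on_def)
  have same_trans: "same_kernel_on W f g \<Longrightarrow> same_kernel_on W g h \<Longrightarrow> same_kernel_on W f h"
    for W and f g h :: "'a \<Rightarrow> nat"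
    by (auto simp: same_kernel_on_def)
  have no_K4: "\<not> has_bell_K4 k G"
  proof
    assume "has_bell_K4 k G"
    then obtain F where F: "F \<subseteq> {A, B, C, D}" "card F = 4"
      "\<And>P Q. P \<in> F \<Longrightarrow> Q \<in> F \<Longrightarrow> P \<noteq> Q \<Longrightarrow> (P, Q) \<in> parcs (bell_coloring_graph k G)"
      unfolding has_bell_K4_def verts by blast
    have "card {A, B, C, D} \<le> 4"
      by (intro order_trans[OF card_insert_le_m1]) auto
    then have "F = {A, B, C, D}"
      using F by (intro card_seteq) auto
    then show False
      using F(3)[of A B] nonarc by auto
  qed
  \<comment> \<open>Without a \<open>K4\<close>, \<open>bell_triangle\<close> leaves only the case
    of one vertex accounting for the whole triangle.\<close>
  have common: "\<exists>v\<in>?V. same_kernel_on (?V - {v}) f c \<and> same_kernel_on (?V - {v}) c d"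
    if f: "proper_coloring k G f" "(?C f, C) \<in> parcs (bell_coloring_graph k G)"
      "(?C f, D) \<in> parcs (bell_coloring_graph k G)" for f
  proof -
    obtain x y z where "x \<in> ?V" "y \<in> ?V" "z \<in> ?V" "same_kernel_on (?V - {x}) f c"
      "same_kernel_on (?V - {y}) c d" "same_kernel_on (?V - {z}) f d"
      using f arcs(5) proper by (auto simp: ABCD bell_arc_iff)
    then show ?thesis
      using bell_triangle[OF f(1) proper(3,4)] no_K4 by blast
  qed
  obtain v where v: "v \<in> ?V" "same_kernel_on (?V - {v}) a c" "same_kernel_on (?V - {v}) c d"
    using common[of a] arcs proper by (auto simp: ABCD)
  obtain w where w: "w \<in> ?V" "same_kernel_on (?V - {w}) b c" "same_kernel_on (?V - {w}) c d"
    using common[of b] arcs proper by (auto simp: ABCD)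
  have neq: "\<not> same_kernel_on ?V a c" "\<not> same_kernel_on ?V a d" "\<not> same_kernel_on ?V b c"
    "\<not> same_kernel_on ?V b d" "\<not> same_kernel_on ?V c d"
    using arcs proper by (auto simp: ABCD bell_arc_iff)
  \<comment> \<open>If \<open>v = w\<close>, then \<open>a\<close> and \<open>b\<close> agree off
    \<open>v\<close>, which makes the distinct vertices \<open>A\<close> and \<open>B\<close>
    adjacent.\<close>
  have "v \<noteq> w"
  proof
    assume "v = w"
    then have "same_kernel_on (?V - {v}) a b"
      using v w same_sym same_trans by metis
    then show False
      using nonarc v(1) proper by (auto simp: ABCD bell_arc_iff color_classes_eq_iff_proper)
  qed
  \<comment> \<open>Any other pair of vertices avoids \<open>v\<close> or \<open>w\<close>, so
    \<open>c\<close> and \<open>d\<close> can differ only on this one.\<close>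
  have "c v = c w \<longleftrightarrow> d v \<noteq> d w"
  proof (rule ccontr)
    assume "\<not> ?thesis"
    then have "c u = c u' \<longleftrightarrow> d u = d u'" if "u \<in> ?V" "u' \<in> ?V" for u u'
      using that same_kernel_onD[OF v(3), of u u'] same_kernel_onD[OF w(3), of u u'] \<open>v \<noteq> w\<close>
      by (cases "u = v"; cases "u = w"; cases "u' = v"; cases "u' = w") auto
    then show False using neq(5) by (auto simp: same_kernel_on_def)
  qed
  moreover have ad: "same_kernel_on (?V - {v}) a d" "same_kernel_on (?V - {w}) b d"
    using v w same_trans by blast+
  \<comment> \<open>If \<open>c\<close> separates \<open>v\<close> and \<open>w\<close>, the roles
    of \<open>c\<close> and \<open>d\<close> are exchanged.\<close>
  ultimately have "\<exists>e. proper_coloring k G e \<and> (\<forall>f\<in>{a, b, c, d}. \<not> same_kernel_on ?V e f)"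
    using fifth_coloring[OF proper v(1) w(1) ad(1) v(3) ad(2) w(3) neq(1-4) \<open>v \<noteq> w\<close>]
      fifth_coloring[OF proper(1,2,4,3) v(1) w(1) v(2) _ w(2) _ neq(2,1,4,3) \<open>v \<noteq> w\<close>]
      v(3) w(3) same_sym by (cases "c v = c w") (simp; blast)+
  then obtain e where e: "proper_coloring k G e" "\<forall>f\<in>{a, b, c, d}. \<not> same_kernel_on ?V e f"
    by blast
  then have "?C e \<notin> {A, B, C, D}"
    using proper by (auto simp: ABCD color_classes_eq_iff_proper)
  moreover have "?C e \<in> {A, B, C, D}"
    using e(1) verts pverts_bell_coloring_graph[of k G] by blast
  ultimately show False by blast
qed

section \<open>Transfer along the isomorphism\<close>

theorem theorem3p9:
  fixes G :: "'a pair_pre_digraph" and k :: nat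
  assumes "pair_graph G" and "0 < k"
  shows "\<not> digraph_iso (with_proj diamond_graph) (with_proj (bell_coloring_graph k G))"
proof
  let ?B = "bell_coloring_graph k G"
  assume "digraph_iso (with_proj diamond_graph) (with_proj ?B)"
  then obtain h where h: "pre_digraph.digraph_isomorphism (with_proj diamond_graph) h"
    and B: "with_proj ?B = app_iso h (with_proj diamond_graph)"
    unfolding digraph_iso_def by blast
  define f where "f = iso_verts h"
  have verts: "pverts ?B = f ` pverts diamond_graph"
    using arg_cong[OF B, of verts] by (simp add: f_def)
  have inj: "inj_on f (pverts diamond_graph)"
    using h by (simp add: pre_digraph.digraph_isomorphism_def f_def)
  \<comment> \<open>Tail and head in \<open>with_proj ?B\<close> are \<open>fst\<close> and
    \<open>snd\<close>, so the action on arcs is determined by the action on vertices.\<close>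
  have "iso_arcs h e = (f (fst e), f (snd e))" if "e \<in> parcs diamond_graph" for e
    using that h arg_cong[OF B, of tail] arg_cong[OF B, of head]
    by (simp add: pre_digraph.digraph_isomorphism_def f_def prod_eq_iff)
  then have arcs: "parcs ?B = (\<lambda>(u, v). (f u, f v)) ` parcs diamond_graph"
    using arg_cong[OF B, of arcs] by (force simp: image_iff)
  have "(f u, f v) \<in> parcs ?B \<longleftrightarrow> (u, v) \<in> parcs diamond_graph"
    if "u \<in> pverts diamond_graph" "v \<in> pverts diamond_graph" for u v
  proof
    assume "(f u, f v) \<in> parcs ?B"
    then obtain u' v' where "(u', v') \<in> parcs diamond_graph" "f u = f u'" "f v = f v'"
      using arcs by auto
    moreover from this have "u' \<in> pverts diamond_graph" "v' \<in> pverts diamond_graph"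
      by (auto simp: diamond_graph_def)
    ultimately show "(u, v) \<in> parcs diamond_graph"
      using inj that by (metis inj_onD)
  qed (force simp: arcs)
  then show False
    using inj verts
    by (intro bell_not_diamond[of k G "f 0" "f 1" "f 2" "f 3"])
      (auto simp: diamond_graph_def inj_on_def)
qed

end
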